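(* Let $G$ be an efficiently non-solvable (ENS) group and let $\Sigma$ be a finite standard generating set for $G$. Then every language $L\subseteq\{0,1\}^*$ in (non-uniform) $\mathsf{NC}^1$ can be recognized by a family of $(G,\Sigma)$-programs of polynomial length. In particular, the word problem of $G$ is hard for $\mathsf{NC}^1$ under projection reductions as well as under $\mathsf{AC}^0$-many-one-reductions.
   Context: Groups. A finite standard generating set of a finitely generated group $G$ is $\Sigma=S\cup S^{-1}\cup\{1\}$, where $S$ is a finite set together with a surjective homomorphism from the free group on $S$ onto $G$; words over $\Sigma$ are evaluated in $G$, the letter $1$ evaluating to the identity. For words, $(a_1\cdots a_n)^{-1}=a_n^{-1}\cdots a_1^{-1}$ and $[h,g]=h^{-1}g^{-1}hg$. The word problem of $G$ is $\{w\in\Sigma^*: w=_G1\}$; as a binary language, letters of $\Sigma$ are encoded by distinct binary words of one common length, which is a power of two. ENS. $G$ is efficiently non-solvable (ENS) if there is an even constant $l$ such that for every $d\in\mathbb{N}$ there is a collection of words $g_{d,v}\in\Sigma^*$, $v\in\{1,\dots,l\}^{\le d}$ (words of length at most $d$ over $\{1,\dots,l\}$), such that (a) $|g_{d,v}|\in2^{O(d)}$ when $|v|=d$ (uniformly in $v$); (b) $g_{d,v}=[g_{d,v1},g_{d,v2}]\cdots[g_{d,v(l-1)},g_{d,vl}]$ when $|v|<d$; (c) $g_{d,\varepsilon}\ne1$ in $G$, where $\varepsilon$ is the empty word. (This does not depend on the choice of $\Sigma$.) Programs. A $(G,\Sigma)$-program $P$ of length $m$ and input length $n$ is a sequence of instructions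 $\langle i_j,b_j,c_j\rangle$, $0\le j\le m-1$, with $i_j\in\{1,\dots,n\}$, $b_j,c_j\in\Sigma$. On input $x=a_1\cdots a_n\in\{0,1\}^n$ the instruction $\langle i_j,b_j,c_j\rangle$ evaluates to $b_j$ if $a_{i_j}=1$ and to $c_j$ otherwise; $P[x]\in\Sigma^*$ is the product of the evaluations in order. A family $(P_n)_n$ with $P_n$ of input length $n$ recognizes (accepts) the language of all $x$ with $P_{|x|}[x]=_G1$. Input length $n=0$ is disregarded. Complexity. $\mathsf{NC}^1$ is the class of languages recognized by (non-uniform) families of boolean circuits of bounded fan-in and depth $O(\log n)$. $\mathsf{AC}^0$-functions are computed by constant-depth polynomial-size circuits with unbounded fan-in and/or gates and not gates. A projection is a function $f:\{0,1\}^*\to\{0,1\}^*$ for which there is $d(n)\in O(\log n)$ with $|f(x)|=2^{d(n)}$ whenever $|x|=n$, and such that for each $n$ every output bit depends on at most one input bit: for each output position $i$ there are $j\in\{1,\dots,n\}$ and $a,b\in\{0,1\}$ such that for all $x\in\{0,1\}^n$ the $i$-th bit of $f(x)$ is $a$ if the $j$-th bit of $x$ is $1$ and $b$ if it is $0$. A projection reduction is a many-one reduction by a projection. *)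

theory Defs
  imports Complex_Main "HOL-Library.Landau_Symbols" "HOL-Algebra.Group"
begin

section \<open>Words over a finite standard generating set\<close>

text \<open>
  The letters of \<open>\<Sigma> = S \<union> S\<^sup>-\<^sup>1 \<union> {1}\<close> are formal symbols: distinct letters may evaluate to the
  same group element, as is the case for generators taken from a free group on \<open>S\<close>.
\<close>

datatype 's letter = Pos 's | Neg 's | One

definition Sigma_of :: "'s set \<Rightarrow> 's letter set" where
  "Sigma_of S = Pos ` S \<union> Neg ` S \<union> {One}"

fun letter_inv :: "'s letter \<Rightarrow> 's letter" where
  "letter_inv (Pos s) = Neg s"
| "letter_inv (Neg s) = Pos s"
| "letter_inv One = One"

definition word_inv :: "'s letter list \<Rightarrow> 's letter list" where
  "word_inv w = map letter_inv (rev w)"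

definition word_comm :: "'s letter list \<Rightarrow> 's letter list \<Rightarrow> 's letter list" where
  "word_comm h g = word_inv h @ word_inv g @ h @ g"

fun letter_eval :: "('g, 'm) monoid_scheme \<Rightarrow> ('s \<Rightarrow> 'g) \<Rightarrow> 's letter \<Rightarrow> 'g" where
  "letter_eval G \<phi> (Pos s) = \<phi> s"
| "letter_eval G \<phi> (Neg s) = inv\<^bsub>G\<^esub> (\<phi> s)"
| "letter_eval G \<phi> One = \<one>\<^bsub>G\<^esub>"

definition word_eval :: "('g, 'm) monoid_scheme \<Rightarrow> ('s \<Rightarrow> 'g) \<Rightarrow> 's letter list \<Rightarrow> 'g" where
  "word_eval G \<phi> w = foldr (\<lambda>a y. letter_eval G \<phi> a \<otimes>\<^bsub>G\<^esub> y) w \<one>\<^bsub>G\<^esub>"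

text \<open>
  A homomorphism from the free group on \<open>S\<close> to \<open>G\<close> is given by its restriction \<open>\<phi>\<close> to \<open>S\<close>; it maps
  the element represented by a word \<open>w\<close> to \<open>word_eval G \<phi> w\<close>. The last conjunct below is its
  surjectivity.
\<close>

definition standard_generating ::
    "('g, 'm) monoid_scheme \<Rightarrow> 's set \<Rightarrow> ('s \<Rightarrow> 'g) \<Rightarrow> bool" where
  "standard_generating G S \<phi> \<longleftrightarrow>
     finite S \<and> \<phi> ` S \<subseteq> carrier G \<and> word_eval G \<phi> ` lists (Sigma_of S) = carrier G"

section \<open>Efficiently non-solvable groups\<close>

text \<open>
  The index \<open>v\<close> is a list over \<open>{1..l}\<close>, and \<open>g d v\<close> is the word \<open>g\<^bsub>d,v\<^esub>\<close>. The bound \<open>2 powr e d\<close>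
  with \<open>e \<in> O(d)\<close> does not depend on \<open>v\<close>. The recursion is an equation between words.
\<close>

definition ENS_wrt :: "('g, 'm) monoid_scheme \<Rightarrow> 's set \<Rightarrow> ('s \<Rightarrow> 'g) \<Rightarrow> bool" where
  "ENS_wrt G S \<phi> \<longleftrightarrow>
     (\<exists>(l::nat) (g :: nat \<Rightarrow> nat list \<Rightarrow> 's letter list) (e :: nat \<Rightarrow> real).
        even l \<and> e \<in> O(\<lambda>d. real d) \<and>
        (\<forall>d.
          (\<forall>v\<in>lists {1..l}. length v \<le> d \<longrightarrow> g d v \<in> lists (Sigma_of S)) \<and>
          (\<forall>v\<in>lists {1..l}. length v = d \<longrightarrow> real (length (g d v)) \<le> 2 powr e d) \<and>
          (\<forall>v\<in>lists {1..l}. length v < d \<longrightarrow>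
             g d v = concat (map (\<lambda>i. word_comm (g d (v @ [2 * i - 1])) (g d (v @ [2 * i])))
                                 [1..<Suc (l div 2)])) \<and>
          word_eval G \<phi> (g d []) \<noteq> \<one>\<^bsub>G\<^esub>))"

text \<open>
  The property does not depend on the generating set, so one existentially quantified generating
  set suffices. Indexing it by a finite set of natural numbers is no restriction.
\<close>

definition efficiently_non_solvable :: "('g, 'm) monoid_scheme \<Rightarrow> bool" where
  "efficiently_non_solvable G \<longleftrightarrow>
     (\<exists>(S :: nat set) \<phi>. standard_generating G S \<phi> \<and> ENS_wrt G S \<phi>)"

section \<open>Programs over a group\<close>

definition polynomially_bounded :: "(nat \<Rightarrow> nat) \<Rightarrow> bool" where
  "polynomially_bounded f \<longleftrightarrow> (\<exists>k::nat. (\<lambda>n. real (f n)) \<in> O(\<lambda>n. real n ^ k))"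

type_synonym 's program = "(nat \<times> 's letter \<times> 's letter) list"

definition is_program :: "'s set \<Rightarrow> nat \<Rightarrow> 's program \<Rightarrow> bool" where
  "is_program S n P \<longleftrightarrow>
     (\<forall>(i, b, c)\<in>set P. i \<in> {1..n} \<and> b \<in> Sigma_of S \<and> c \<in> Sigma_of S)"

definition program_output :: "'s program \<Rightarrow> bool list \<Rightarrow> 's letter list" where
  "program_output P x = map (\<lambda>(i, b, c). if x ! (i - 1) then b else c) P"

text \<open>Input length 0 is disregarded: an instruction cannot query a bit of the empty input.\<close>

definition program_family :: "'s set \<Rightarrow> (nat \<Rightarrow> 's program) \<Rightarrow> bool" where
  "program_family S P \<longleftrightarrow> (\<forall>n\<ge>1. is_program S n (P n))"

definition recognizes ::
    "('g, 'm) monoid_scheme \<Rightarrow> ('s \<Rightarrow> 'g) \<Rightarrow> (nat \<Rightarrow> 's program) \<Rightarrow> bool list set \<Rightarrow> bool" where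
  "recognizes G \<phi> P L \<longleftrightarrow>
     (\<forall>x. x \<noteq> [] \<longrightarrow>
        (x \<in> L \<longleftrightarrow> word_eval G \<phi> (program_output (P (length x)) x) = \<one>\<^bsub>G\<^esub>))"

section \<open>The word problem as a binary language\<close>

definition binary_encoding :: "'s set \<Rightarrow> ('s letter \<Rightarrow> bool list) \<Rightarrow> bool" where
  "binary_encoding S enc \<longleftrightarrow>
     inj_on enc (Sigma_of S) \<and> (\<exists>k::nat. \<forall>a\<in>Sigma_of S. length (enc a) = 2 ^ k)"

definition word_problem ::
    "('g, 'm) monoid_scheme \<Rightarrow> 's set \<Rightarrow> ('s \<Rightarrow> 'g) \<Rightarrow> 's letter list set" where
  "word_problem G S \<phi> = {w \<in> lists (Sigma_of S). word_eval G \<phi> w = \<one>\<^bsub>G\<^esub>}"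

definition binary_word_problem ::
    "('g, 'm) monoid_scheme \<Rightarrow> 's set \<Rightarrow> ('s \<Rightarrow> 'g) \<Rightarrow> ('s letter \<Rightarrow> bool list) \<Rightarrow> bool list set" where
  "binary_word_problem G S \<phi> enc = (\<lambda>w. concat (map enc w)) ` word_problem G S \<phi>"

section \<open>Boolean circuits\<close>

text \<open>
  A circuit is a directed acyclic graph given as a list of gates in topological order together with
  a list of output gates. The arguments of a gate are positions of earlier gates; \<open>GIn i\<close> is the
  input bit with 0-based index \<open>i\<close>. The gates \<open>GAnd []\<close> and \<open>GOr []\<close> are the Boolean constants.
\<close>

datatype gate = GIn nat | GNot nat | GAnd "nat list" | GOr "nat list"

datatype circuit = Circuit (gates: "gate list") (outputs: "nat list")

fun gate_args :: "gate \<Rightarrow> nat list" where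
  "gate_args (GIn i) = []"
| "gate_args (GNot k) = [k]"
| "gate_args (GAnd ks) = ks"
| "gate_args (GOr ks) = ks"

definition is_circuit :: "nat \<Rightarrow> circuit \<Rightarrow> bool" where
  "is_circuit n C \<longleftrightarrow>
     (\<forall>k<length (gates C). \<forall>j\<in>set (gate_args (gates C ! k)). j < k) \<and>
     (\<forall>i. GIn i \<in> set (gates C) \<longrightarrow> i < n) \<and>
     (\<forall>k\<in>set (outputs C). k < length (gates C))"

fun gate_value :: "bool list \<Rightarrow> bool list \<Rightarrow> gate \<Rightarrow> bool" where
  "gate_value x vs (GIn i) = x ! i"
| "gate_value x vs (GNot k) = (\<not> vs ! k)"
| "gate_value x vs (GAnd ks) = (\<forall>k\<in>set ks. vs ! k)"
| "gate_value x vs (GOr ks) = (\<exists>k\<in>set ks. vs ! k)"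

definition gate_values :: "bool list \<Rightarrow> gate list \<Rightarrow> bool list" where
  "gate_values x gs = foldl (\<lambda>vs g. vs @ [gate_value x vs g]) [] gs"

definition circuit_eval :: "circuit \<Rightarrow> bool list \<Rightarrow> bool list" where
  "circuit_eval C x = map (\<lambda>k. gate_values x (gates C) ! k) (outputs C)"

fun gate_depth :: "nat list \<Rightarrow> gate \<Rightarrow> nat" where
  "gate_depth ds (GIn i) = 0"
| "gate_depth ds (GNot k) = Suc (ds ! k)"
| "gate_depth ds (GAnd ks) = Suc (Max (insert 0 ((\<lambda>k. ds ! k) ` set ks)))"
| "gate_depth ds (GOr ks) = Suc (Max (insert 0 ((\<lambda>k. ds ! k) ` set ks)))"

definition gate_depths :: "gate list \<Rightarrow> nat list" where
  "gate_depths gs = foldl (\<lambda>ds g. ds @ [gate_depth ds g]) [] gs"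

definition circuit_depth :: "circuit \<Rightarrow> nat" where
  "circuit_depth C = Max (insert 0 (set (gate_depths (gates C))))"

text \<open>The outputs are counted because the same gate may be used for several output bits.\<close>

definition circuit_size :: "circuit \<Rightarrow> nat" where
  "circuit_size C = length (gates C) + length (outputs C)"

definition fan_in_at_most :: "nat \<Rightarrow> circuit \<Rightarrow> bool" where
  "fan_in_at_most b C \<longleftrightarrow> (\<forall>g\<in>set (gates C). length (gate_args g) \<le> b)"

section \<open>Complexity classes and reductions\<close>

definition NC1 :: "bool list set set" where
  "NC1 = {L. \<exists>(C :: nat \<Rightarrow> circuit) (b::nat).
      (\<forall>n. is_circuit n (C n) \<and> fan_in_at_most b (C n)) \<and>
      (\<lambda>n. real (circuit_depth (C n))) \<in> O(\<lambda>n. log 2 (real n)) \<and>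
      (\<forall>x. circuit_eval (C (length x)) x = [x \<in> L])}"

definition AC0_function :: "(bool list \<Rightarrow> bool list) \<Rightarrow> bool" where
  "AC0_function f \<longleftrightarrow> (\<exists>(C :: nat \<Rightarrow> circuit) (D::nat).
      (\<forall>n. is_circuit n (C n) \<and> circuit_depth (C n) \<le> D) \<and>
      polynomially_bounded (\<lambda>n. circuit_size (C n)) \<and>
      (\<forall>x. f x = circuit_eval (C (length x)) x))"

text \<open>
  For the empty input only the length of the output is prescribed, as there is no input bit for
  an output bit to depend on.
\<close>

definition projection :: "(bool list \<Rightarrow> bool list) \<Rightarrow> bool" where
  "projection f \<longleftrightarrow> (\<exists>d :: nat \<Rightarrow> nat.
      (\<lambda>n. real (d n)) \<in> O(\<lambda>n. log 2 (real n)) \<and>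
      (\<forall>x. length (f x) = 2 ^ d (length x)) \<and>
      (\<forall>n\<ge>1. \<forall>i\<in>{1..2 ^ d n}. \<exists>j\<in>{1..n}. \<exists>a b.
         \<forall>x. length x = n \<longrightarrow> f x ! (i - 1) = (if x ! (j - 1) then a else b)))"

definition many_one_reduction ::
    "(bool list \<Rightarrow> bool list) \<Rightarrow> bool list set \<Rightarrow> bool list set \<Rightarrow> bool" where
  "many_one_reduction f L K \<longleftrightarrow> (\<forall>x. x \<in> L \<longleftrightarrow> f x \<in> K)"

definition hard_under ::
    "((bool list \<Rightarrow> bool list) \<Rightarrow> bool) \<Rightarrow> bool list set set \<Rightarrow> bool list set \<Rightarrow> bool" where
  "hard_under R \<C> K \<longleftrightarrow> (\<forall>L\<in>\<C>. \<exists>f. R f \<and> many_one_reduction f L K)"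

end

theory Submission
  imports Defs "HOL-Real_Asymp.Real_Asymp"
begin

text \<open>
  A circuit of logarithmic depth unfolds to a NAND formula of height \<open>d \<in> O(log n)\<close>. At the tree
  position \<open>v\<close>, a subformula is simulated by a program that evaluates to \<open>g\<^bsub>d,v\<^esub>\<close> if the subformula is
  true and to \<open>1\<close> otherwise. A commutator with a trivial entry is trivial, so replacing the words in
  \<open>[g\<^bsub>d,v1\<^esub>, g\<^bsub>d,v2\<^esub>] \<cdots> [g\<^bsub>d,v(l-1)\<^esub>, g\<^bsub>d,vl\<^esub>]\<close> by programs for \<open>E\<close> (odd positions) and \<open>F\<close> (even
  positions) simulates the conjunction of \<open>E\<close> and \<open>F\<close>, and \<open>g\<^bsub>d,v\<^esub>\<close> times the inverse of that product
  simulates its negation. Each level multiplies the length by a constant, hence it is \<open>2\<^bsup>O(d)\<^esup>\<close>, which is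
  polynomial in \<open>n\<close>. The encoded output of such a program, padded by trivial letters, depends bitwise
  on single input bits, and every such projection is computed by circuits of depth at most \<open>1\<close>.
\<close>

section \<open>Evaluation of words\<close>

lemma word_inv_in_lists: "w \<in> lists (Sigma_of S) \<Longrightarrow> word_inv w \<in> lists (Sigma_of S)"
proof -
  have "letter_inv a \<in> Sigma_of S" if "a \<in> Sigma_of S" for a
    using that by (cases a) (auto simp: Sigma_of_def)
  then show "w \<in> lists (Sigma_of S) \<Longrightarrow> ?thesis"
    by (auto simp: word_inv_def in_lists_conv_set)
qed

lemma length_word_inv [simp]: "length (word_inv w) = length w"
  by (simp add: word_inv_def)

lemma word_comm_in_lists:
  "h \<in> lists (Sigma_of S) \<Longrightarrow> g \<in> lists (Sigma_of S) \<Longrightarrow> word_comm h g \<in> lists (Sigma_of S)"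
  using word_inv_in_lists[of h S] word_inv_in_lists[of g S] by (auto simp: word_comm_def)

context group
begin

context
  fixes S :: "'s set" and \<phi> :: "'s \<Rightarrow> 'a"
  assumes gens: "\<phi> ` S \<subseteq> carrier G"
begin

lemma letter_eval_closed: "a \<in> Sigma_of S \<Longrightarrow> letter_eval G \<phi> a \<in> carrier G"
  using gens by (cases a) (auto simp: Sigma_of_def)

lemma letter_eval_inv: "a \<in> Sigma_of S \<Longrightarrow> letter_eval G \<phi> (letter_inv a) = inv (letter_eval G \<phi> a)"
  using gens by (cases a) (auto simp: Sigma_of_def)

lemma word_eval_closed: "w \<in> lists (Sigma_of S) \<Longrightarrow> word_eval G \<phi> w \<in> carrier G"
  by (induction w) (auto simp: word_eval_def letter_eval_closed)

lemma word_eval_append: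
  "u \<in> lists (Sigma_of S) \<Longrightarrow> w \<in> lists (Sigma_of S) \<Longrightarrow>
    word_eval G \<phi> (u @ w) = word_eval G \<phi> u \<otimes> word_eval G \<phi> w"
proof (induction u)
  case Nil
  then show ?case using word_eval_closed[of w] by (simp add: word_eval_def)
next
  case (Cons a u)
  then show ?case
    using word_eval_closed[of w] word_eval_closed[of u] letter_eval_closed[of a]
    by (simp add: word_eval_def m_assoc)
qed

lemma word_eval_inv:
  "w \<in> lists (Sigma_of S) \<Longrightarrow> word_eval G \<phi> (word_inv w) = inv (word_eval G \<phi> w)"
proof (induction w)
  case Nil
  then show ?case by (simp add: word_eval_def word_inv_def)
next
  case (Cons a w)
  have a: "a \<in> Sigma_of S" and w: "w \<in> lists (Sigma_of S)" using Cons.prems by auto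
  have ai: "[letter_inv a] \<in> lists (Sigma_of S)"
    using word_inv_in_lists[of "[a]" S] a by (simp add: word_inv_def)
  have "word_eval G \<phi> (word_inv (a # w)) = word_eval G \<phi> (word_inv w @ [letter_inv a])"
    by (simp add: word_inv_def)
  also have "\<dots> = inv (word_eval G \<phi> w) \<otimes> word_eval G \<phi> [letter_inv a]"
    using Cons.IH w ai by (simp add: word_eval_append word_inv_in_lists)
  also have "word_eval G \<phi> [letter_inv a] = inv (letter_eval G \<phi> a)"
    using letter_eval_inv[OF a] letter_eval_closed[OF a] by (simp add: word_eval_def)
  finally show ?case
    using letter_eval_closed[OF a] word_eval_closed[OF w]
    by (simp add: word_eval_def inv_mult_group)
qed

lemma word_eval_comm:
  assumes "h \<in> lists (Sigma_of S)" "g \<in> lists (Sigma_of S)"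
  shows "word_eval G \<phi> (word_comm h g) =
    inv (word_eval G \<phi> h) \<otimes> (inv (word_eval G \<phi> g) \<otimes> (word_eval G \<phi> h \<otimes> word_eval G \<phi> g))"
  using assms word_inv_in_lists[of h S] word_inv_in_lists[of g S]
  by (simp add: word_comm_def word_eval_append word_eval_inv del: append_in_lists_conv)
     (simp add: word_eval_append word_eval_inv)

lemma word_eval_comm_trivial:
  assumes "h \<in> lists (Sigma_of S)" "g \<in> lists (Sigma_of S)"
    and "word_eval G \<phi> h = \<one> \<or> word_eval G \<phi> g = \<one>"
  shows "word_eval G \<phi> (word_comm h g) = \<one>"
  using assms word_eval_closed[of h] word_eval_closed[of g] by (auto simp: word_eval_comm l_inv)

lemma word_eval_concat_trivial:
  assumes "\<And>i. i \<in> set is \<Longrightarrow> u i \<in> lists (Sigma_of S) \<and> word_eval G \<phi> (u i) = \<one>"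
  shows "word_eval G \<phi> (concat (map u is)) = \<one>"
  using assms
proof (induction "is")
  case (Cons i "is")
  have "concat (map u is) \<in> lists (Sigma_of S)"
    using Cons.prems by (auto simp: in_lists_conv_set)
  then show ?case using Cons by (simp add: word_eval_append)
qed (simp add: word_eval_def)

end

text \<open>Two generating systems are allowed so that words can be translated from one to the other.\<close>

lemma word_eval_concat_cong:
  assumes "\<phi> ` S \<subseteq> carrier G" "\<psi> ` T \<subseteq> carrier G"
    and "\<And>i. i \<in> set is \<Longrightarrow> u i \<in> lists (Sigma_of S)"
    and "\<And>i. i \<in> set is \<Longrightarrow> w i \<in> lists (Sigma_of T)"
    and "\<And>i. i \<in> set is \<Longrightarrow> word_eval G \<phi> (u i) = word_eval G \<psi> (w i)"
  shows "word_eval G \<phi> (concat (map u is)) = word_eval G \<psi> (concat (map w is))"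
  using assms(3-)
proof (induction "is")
  case (Cons i "is")
  have "concat (map u is) \<in> lists (Sigma_of S)" "concat (map w is) \<in> lists (Sigma_of T)"
    using Cons.prems by (auto simp: in_lists_conv_set)
  then show ?case using Cons by (simp add: word_eval_append[OF assms(1)] word_eval_append[OF assms(2)])
qed (simp add: word_eval_def)

end

section \<open>Products of commutators\<close>

text \<open>With \<open>a i\<close> and \<open>b i\<close> the words at the children 2i - 1 and 2i
  of v, this is the right-hand side of the ENS recursion. Keeping odd and even entries as two
  functions allows programs for two different subformulas to take their places.\<close>

definition comm_prod :: "nat \<Rightarrow> (nat \<Rightarrow> 's letter list) \<Rightarrow> (nat \<Rightarrow> 's letter list) \<Rightarrow> 's letter list" where
  "comm_prod l a b = concat (map (\<lambda>i. word_comm (a i) (b i)) [1..<Suc (l div 2)])"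

lemma length_comm_prod_le:
  assumes "\<And>i. i \<in> {1..l div 2} \<Longrightarrow> length (a i) \<le> M \<and> length (b i) \<le> M"
  shows "length (comm_prod l a b) \<le> 2 * l * M"
proof -
  have "length (comm_prod l a b) = (\<Sum>i\<in>{1..l div 2}. length (word_comm (a i) (b i)))"
    by (simp add: comm_prod_def length_concat comp_def interv_sum_list_conv_sum_set_nat
        atLeastLessThanSuc_atLeastAtMost del: upt_Suc)
  also have "\<dots> \<le> (\<Sum>i\<in>{1..l div 2}. 4 * M)"
    using assms by (intro sum_mono) (fastforce simp: word_comm_def)
  also have "\<dots> = (l div 2 * 2) * (2 * M)" by simp
  also have "\<dots> \<le> l * (2 * M)" by (intro mult_right_mono) auto
  finally show ?thesis by simp
qed

lemma comm_prod_in_lists: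
  assumes "\<And>i. i \<in> {1..l div 2} \<Longrightarrow> a i \<in> lists (Sigma_of S) \<and> b i \<in> lists (Sigma_of S)"
  shows "comm_prod l a b \<in> lists (Sigma_of S)"
proof -
  have "word_comm (a i) (b i) \<in> lists (Sigma_of S)" if "i \<in> {1..l div 2}" for i
    using assms[OF that] word_comm_in_lists by blast
  then show ?thesis
    unfolding comm_prod_def in_lists_conv_set by (force simp del: upt_Suc)
qed

context group
begin

text \<open>Two uses are intended: with a single generating system, to compare program outputs with
  the words they simulate, and with two systems, to carry the ENS recursion over to another
  generating set.\<close>

lemma comm_prod_cong:
  assumes gens: "\<phi> ` S \<subseteq> carrier G" "\<psi> ` T \<subseteq> carrier G"
    and "\<And>i. i \<in> {1..l div 2} \<Longrightarrow> a i \<in> lists (Sigma_of S) \<and> b i \<in> lists (Sigma_of S)"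
    and "\<And>i. i \<in> {1..l div 2} \<Longrightarrow> a' i \<in> lists (Sigma_of T) \<and> b' i \<in> lists (Sigma_of T)"
    and "\<And>i. i \<in> {1..l div 2} \<Longrightarrow> word_eval G \<phi> (a i) = word_eval G \<psi> (a' i) \<and>
            word_eval G \<phi> (b i) = word_eval G \<psi> (b' i)"
  shows "word_eval G \<phi> (comm_prod l a b) = word_eval G \<psi> (comm_prod l a' b')"
  unfolding comm_prod_def
proof (rule word_eval_concat_cong[OF gens])
  fix i assume "i \<in> set [1..<Suc (l div 2)]"
  then have i: "i \<in> {1..l div 2}" by auto
  note facts = assms(3)[OF i] assms(4)[OF i] assms(5)[OF i]
  show "word_comm (a i) (b i) \<in> lists (Sigma_of S)" "word_comm (a' i) (b' i) \<in> lists (Sigma_of T)"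
    using facts word_comm_in_lists by blast+
  show "word_eval G \<phi> (word_comm (a i) (b i)) = word_eval G \<psi> (word_comm (a' i) (b' i))"
    using facts by (simp add: word_eval_comm[OF gens(1)] word_eval_comm[OF gens(2)])
qed

lemma comm_prod_trivial:
  assumes gens: "\<phi> ` S \<subseteq> carrier G"
    and "\<And>i. i \<in> {1..l div 2} \<Longrightarrow> a i \<in> lists (Sigma_of S) \<and> b i \<in> lists (Sigma_of S)"
    and "\<And>i. i \<in> {1..l div 2} \<Longrightarrow> word_eval G \<phi> (a i) = \<one> \<or> word_eval G \<phi> (b i) = \<one>"
  shows "word_eval G \<phi> (comm_prod l a b) = \<one>"
  unfolding comm_prod_def
proof (rule word_eval_concat_trivial[OF gens])
  fix i assume "i \<in> set [1..<Suc (l div 2)]"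
  then have i: "i \<in> {1..l div 2}" by auto
  show "word_comm (a i) (b i) \<in> lists (Sigma_of S) \<and> word_eval G \<phi> (word_comm (a i) (b i)) = \<one>"
    using assms(2)[OF i] assms(3)[OF i] word_comm_in_lists word_eval_comm_trivial[OF gens] by blast
qed

end

section \<open>Programs for NAND formulas\<close>

text \<open>A single connective leaves a single recursive construction of programs.
  \<open>Truth\<close> turns NAND into negation and serves as the empty conjunction.\<close>

datatype nand_formula = Truth | Var nat | Nand nand_formula nand_formula

fun formula_eval :: "nand_formula \<Rightarrow> bool list \<Rightarrow> bool" where
  "formula_eval Truth x = True"
| "formula_eval (Var i) x = x ! i"
| "formula_eval (Nand E F) x = (\<not> (formula_eval E x \<and> formula_eval F x))"

fun height :: "nand_formula \<Rightarrow> nat" where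
  "height Truth = 0"
| "height (Var i) = 0"
| "height (Nand E F) = Suc (max (height E) (height F))"

fun formula_vars :: "nand_formula \<Rightarrow> nat set" where
  "formula_vars Truth = {}"
| "formula_vars (Var i) = {i}"
| "formula_vars (Nand E F) = formula_vars E \<union> formula_vars F"

definition program_inv :: "'s program \<Rightarrow> 's program" where
  "program_inv P = map (\<lambda>(i, b, c). (i, letter_inv b, letter_inv c)) (rev P)"

definition program_comm :: "'s program \<Rightarrow> 's program \<Rightarrow> 's program" where
  "program_comm P Q = program_inv P @ program_inv Q @ P @ Q"

text \<open>An instruction has to query some bit. Position 1 exists in every nonempty input, and
  equal branches make the query irrelevant.\<close>

definition constant_program :: "'s letter list \<Rightarrow> 's program" where
  "constant_program w = map (\<lambda>a. (1, a, a)) w"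

text \<open>The word \<open>w v\<close> stands for the value true at position v. Odd children carry
  programs for \<open>E\<close>, even children programs for \<open>F\<close>. If both hold, the
  inverted product is meant to cancel the leading \<open>w v\<close>; otherwise the product is
  trivial and \<open>w v\<close> survives. Variables count from 0 but instructions from 1, hence
  \<open>Suc i\<close>.\<close>

fun nand_program :: "nat \<Rightarrow> (nat list \<Rightarrow> 's letter list) \<Rightarrow> nand_formula \<Rightarrow> nat list \<Rightarrow> 's program" where
  "nand_program l w Truth v = constant_program (w v)"
| "nand_program l w (Var i) v = map (\<lambda>a. (Suc i, a, One)) (w v)"
| "nand_program l w (Nand E F) v = constant_program (w v) @ program_inv (concat
     (map (\<lambda>i. program_comm (nand_program l w E (v @ [2 * i - 1])) (nand_program l w F (v @ [2 * i])))
       [1..<Suc (l div 2)]))"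

section \<open>Outputs and well-formedness of composed programs\<close>

lemma program_output_append [simp]:
  "program_output (P @ Q) x = program_output P x @ program_output Q x"
  by (simp add: program_output_def)

lemma program_output_inv [simp]:
  "program_output (program_inv P) x = word_inv (program_output P x)"
  by (auto simp: program_output_def program_inv_def word_inv_def rev_map)

lemma program_output_comm [simp]:
  "program_output (program_comm P Q) x = word_comm (program_output P x) (program_output Q x)"
  by (simp add: program_comm_def word_comm_def)

lemma program_output_constant [simp]: "program_output (constant_program w) x = w"
  by (simp add: program_output_def constant_program_def comp_def)

lemma program_output_concat [simp]:
  "program_output (concat Ps) x = concat (map (\<lambda>P. program_output P x) Ps)"
  by (induction Ps) (simp_all add: program_output_def)

lemma length_program_output [simp]: "length (program_output P x) = length P"
  by (simp add: program_output_def)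

lemma program_output_in_lists:
  "is_program S n P \<Longrightarrow> program_output P x \<in> lists (Sigma_of S)"
  by (fastforce simp: is_program_def program_output_def)

lemma is_program_append [simp]:
  "is_program S n (P @ Q) \<longleftrightarrow> is_program S n P \<and> is_program S n Q"
  by (simp add: is_program_def ball_Un)

lemma is_program_inv: "is_program S n P \<Longrightarrow> is_program S n (program_inv P)"
  using word_inv_in_lists[of "[_]" S]
  by (fastforce simp: is_program_def program_inv_def word_inv_def)

lemma is_program_comm:
  "is_program S n P \<Longrightarrow> is_program S n Q \<Longrightarrow> is_program S n (program_comm P Q)"
  by (simp add: program_comm_def is_program_inv)

lemma is_program_concat: "(\<And>P. P \<in> set Ps \<Longrightarrow> is_program S n P) \<Longrightarrow> is_program S n (concat Ps)"
  by (auto simp: is_program_def)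

lemma is_program_constant:
  "n \<ge> 1 \<Longrightarrow> w \<in> lists (Sigma_of S) \<Longrightarrow> is_program S n (constant_program w)"
  by (auto simp: is_program_def constant_program_def)

text \<open>In this form the facts about commutator products of words apply to programs, both for
  their values and, as an output is as long as its program, for their lengths.\<close>

lemma program_output_Nand:
  "program_output (nand_program l w (Nand E F) v) x = w v @ word_inv (comm_prod l
     (\<lambda>i. program_output (nand_program l w E (v @ [2 * i - 1])) x)
     (\<lambda>i. program_output (nand_program l w F (v @ [2 * i])) x))"
  by (simp add: comm_prod_def comp_def del: upt_Suc)

lemma child_index:
  fixes l :: nat
  assumes "v \<in> lists {1..l}" "i \<in> {1..l div 2}"
  shows "v @ [2 * i - 1] \<in> lists {1..l}" "v @ [2 * i] \<in> lists {1..l}"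
  using assms by auto

text \<open>The words \<open>w v\<close> are controlled only for indices of length at most
  \<open>d\<close>. The condition \<open>length v + height F \<le> d\<close> keeps the recursion
  there: a call extends v by one index and lowers the height by at least one.\<close>

lemma is_program_nand_program:
  assumes "n \<ge> 1" and w: "\<And>v. v \<in> lists {1..l} \<Longrightarrow> length v \<le> d \<Longrightarrow> w v \<in> lists (Sigma_of S)"
  shows "v \<in> lists {1..l} \<Longrightarrow> length v + height F \<le> d \<Longrightarrow> formula_vars F \<subseteq> {..<n} \<Longrightarrow>
    is_program S n (nand_program l w F v)"
proof (induction F arbitrary: v)
  case Truth
  then show ?case using assms by (simp add: is_program_constant)
next
  case (Var i)
  then show ?case using w[of v] by (auto simp: is_program_def Sigma_of_def)
next
  case (Nand E F)
  have "is_program S n (program_comm (nand_program l w E (v @ [2 * i - 1]))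
      (nand_program l w F (v @ [2 * i])))" if "i \<in> {1..l div 2}" for i
    using Nand.prems child_index[OF Nand.prems(1) that]
    by (intro is_program_comm Nand.IH) auto
  then show ?case
    using Nand.prems \<open>n \<ge> 1\<close> w[of v]
    by (auto intro!: is_program_constant is_program_inv is_program_concat
        simp del: upt_Suc in_listsD in_lists_conv_set)
qed

text \<open>If \<open>M\<close> bounds the programs at all children and also \<open>B\<close>, the
  new length is at most \<open>M + 2 * l * M\<close>, so each level costs a factor
  \<open>Suc (2 * l)\<close>.\<close>

lemma length_nand_program_le:
  assumes w: "\<And>v. v \<in> lists {1..l} \<Longrightarrow> length v \<le> d \<Longrightarrow> length (w v) \<le> B"
  shows "v \<in> lists {1..l} \<Longrightarrow> length v + height F \<le> d \<Longrightarrow>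
    length (nand_program l w F v) \<le> B * Suc (2 * l) ^ height F"
proof (induction F arbitrary: v)
  case (Nand E F)
  define h where "h = max (height E) (height F)"
  define M where "M = B * Suc (2 * l) ^ h"
  have mono: "B * Suc (2 * l) ^ k \<le> M" if "k \<le> h" for k
    unfolding M_def using that by (intro mult_left_mono power_increasing) auto
  have IH: "length (nand_program l w E (v @ [2 * i - 1])) \<le> M \<and>
      length (nand_program l w F (v @ [2 * i])) \<le> M" if "i \<in> {1..l div 2}" for i
  proof -
    have "length (nand_program l w E (v @ [2 * i - 1])) \<le> B * Suc (2 * l) ^ height E"
      "length (nand_program l w F (v @ [2 * i])) \<le> B * Suc (2 * l) ^ height F"
      using Nand.prems child_index[OF Nand.prems(1) that] by (auto intro!: Nand.IH)
    then show ?thesis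
      using mono[of "height E"] mono[of "height F"] by (auto simp: h_def)
  qed
  \<comment> \<open>The length does not depend on the input, so it is read off the output on the
    empty list.\<close>
  have "length (nand_program l w (Nand E F) v)
      = length (program_output (nand_program l w (Nand E F) v) [])"
    by (simp only: length_program_output)
  also have "\<dots> \<le> length (w v) + 2 * l * M"
    unfolding program_output_Nand length_append length_word_inv
    by (intro add_left_mono length_comm_prod_le) (simp only: IH length_program_output simp_thms)
  also have "\<dots> \<le> M + 2 * l * M"
    using w[of v] Nand.prems mono[of 0] by simp
  also have "\<dots> = B * Suc (2 * l) ^ height (Nand E F)"
    by (simp add: M_def h_def algebra_simps)
  finally show ?case .
qed (use w in \<open>auto simp: constant_program_def\<close>)

text \<open>The recursion \<open>rec\<close> is an equality of values in the group, because words
  translated from another generating set need not satisfy it literally.\<close>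

lemma (in group) word_eval_nand_program:
  fixes S :: "'s set"
  assumes gens: "\<phi> ` S \<subseteq> carrier G" and "n \<ge> 1"
    and w: "\<And>v. v \<in> lists {1..l} \<Longrightarrow> length v \<le> d \<Longrightarrow> w v \<in> lists (Sigma_of S)"
    and rec: "\<And>v. v \<in> lists {1..l} \<Longrightarrow> length v < d \<Longrightarrow> word_eval G \<phi> (w v) =
        word_eval G \<phi> (comm_prod l (\<lambda>i. w (v @ [2 * i - 1])) (\<lambda>i. w (v @ [2 * i])))"
  shows "v \<in> lists {1..l} \<Longrightarrow> length v + height F \<le> d \<Longrightarrow> formula_vars F \<subseteq> {..<n} \<Longrightarrow>
    word_eval G \<phi> (program_output (nand_program l w F v) x) =
      (if formula_eval F x then word_eval G \<phi> (w v) else \<one>)"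
proof (induction F arbitrary: v)
  case Truth
  then show ?case by simp
next
  case (Var i)
  have "word_eval G \<phi> (map (\<lambda>a. One) u) = \<one>" for u :: "'s letter list"
    by (induction u) (simp_all add: word_eval_def)
  then show ?case by (auto simp: program_output_def comp_def)
next
  case (Nand E F)
  let ?a = "\<lambda>i. program_output (nand_program l w E (v @ [2 * i - 1])) x"
  let ?b = "\<lambda>i. program_output (nand_program l w F (v @ [2 * i])) x"
  have wv: "w v \<in> lists (Sigma_of S)" using Nand.prems w by simp
  have ab: "?a i \<in> lists (Sigma_of S) \<and> ?b i \<in> lists (Sigma_of S)" if "i \<in> {1..l div 2}" for i
    using Nand.prems child_index[OF Nand.prems(1) that] \<open>n \<ge> 1\<close>
    by (intro conjI program_output_in_lists[where n = n] is_program_nand_program[where d = d] w) auto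
  have IH: "word_eval G \<phi> (?a i) = (if formula_eval E x then word_eval G \<phi> (w (v @ [2 * i - 1])) else \<one>) \<and>
      word_eval G \<phi> (?b i) = (if formula_eval F x then word_eval G \<phi> (w (v @ [2 * i])) else \<one>)"
    if "i \<in> {1..l div 2}" for i
    using Nand.prems child_index[OF Nand.prems(1) that] by (intro conjI Nand.IH) auto
  \<comment> \<open>The product computes the conjunction: if both subformulas hold, its entries have
    the values of the words at the children and \<open>rec\<close> applies; otherwise all odd or all
    even entries are trivial, which kills every commutator.\<close>
  have "word_eval G \<phi> (comm_prod l ?a ?b) =
      (if formula_eval E x \<and> formula_eval F x then word_eval G \<phi> (w v) else \<one>)"
  proof (cases "formula_eval E x \<and> formula_eval F x")
    case True
    have "word_eval G \<phi> (comm_prod l ?a ?b) =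
        word_eval G \<phi> (comm_prod l (\<lambda>i. w (v @ [2 * i - 1])) (\<lambda>i. w (v @ [2 * i])))"
    proof (rule comm_prod_cong[OF gens gens ab])
      show "w (v @ [2 * i - 1]) \<in> lists (Sigma_of S) \<and> w (v @ [2 * i]) \<in> lists (Sigma_of S)"
        if "i \<in> {1..l div 2}" for i
        using Nand.prems child_index[OF Nand.prems(1) that] by (intro conjI w) auto
    qed (use IH True in auto)
    then show ?thesis using rec[of v] Nand.prems True by simp
  next
    case False
    then show ?thesis by (subst comm_prod_trivial[OF gens ab]) (use IH in auto)
  qed
  then show ?case
    using wv word_eval_closed[OF gens wv] comm_prod_in_lists[of l ?a S ?b, OF ab]
    unfolding program_output_Nand
    by (auto simp: word_eval_append[OF gens] word_eval_inv[OF gens] word_inv_in_lists)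
qed

section \<open>From circuits to formulas\<close>

lemma length_foldl_snoc: "length (foldl (\<lambda>vs g. vs @ [h vs g]) [] gs) = length gs"
  by (induction gs rule: rev_induct) simp_all

text \<open>Gate values and gate depths are both built by such a fold. Entries never change once
  appended, so each is determined by the prefix before it.\<close>

lemma nth_foldl_snoc:
  "k < length gs \<Longrightarrow> foldl (\<lambda>vs g. vs @ [h vs g]) [] gs ! k
     = h (take k (foldl (\<lambda>vs g. vs @ [h vs g]) [] gs)) (gs ! k)"
proof (induction gs rule: rev_induct)
  case (snoc g gs)
  then show ?case
    by (cases "k < length gs") (auto simp: nth_append length_foldl_snoc less_Suc_eq)
qed simp

lemma length_gate_depths: "length (gate_depths gs) = length gs"
  unfolding gate_depths_def by (rule length_foldl_snoc)

lemma nth_gate_values: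
  "k < length gs \<Longrightarrow> gate_values x gs ! k = gate_value x (take k (gate_values x gs)) (gs ! k)"
  unfolding gate_values_def by (rule nth_foldl_snoc)

lemma nth_gate_depths:
  "k < length gs \<Longrightarrow> gate_depths gs ! k = gate_depth (take k (gate_depths gs)) (gs ! k)"
  unfolding gate_depths_def by (rule nth_foldl_snoc)

lemma gate_value_cong:
  "(\<And>j. j \<in> set (gate_args g) \<Longrightarrow> vs ! j = us ! j) \<Longrightarrow> gate_value x vs g = gate_value x us g"
  by (cases g) auto

lemma gate_depth_arg: "j \<in> set (gate_args g) \<Longrightarrow> Suc (ds ! j) \<le> gate_depth ds g"
  by (cases g) (auto intro!: Max_ge)

text \<open>A conjunction is a negated NAND, so every conjunct adds height 2. The linear chain is
  affordable since it is applied to at most as many conjuncts as the constant fan-in.\<close>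

fun formula_conj :: "nand_formula list \<Rightarrow> nand_formula" where
  "formula_conj [] = Truth"
| "formula_conj (F # Fs) = Nand (Nand F (formula_conj Fs)) Truth"

lemma formula_eval_conj [simp]: "formula_eval (formula_conj Fs) x \<longleftrightarrow> (\<forall>F\<in>set Fs. formula_eval F x)"
  by (induction Fs) auto

lemma formula_vars_conj [simp]: "formula_vars (formula_conj Fs) = (\<Union>F\<in>set Fs. formula_vars F)"
  by (induction Fs) auto

lemma height_formula_conj_le:
  "(\<And>F. F \<in> set Fs \<Longrightarrow> height F \<le> h) \<Longrightarrow> height (formula_conj Fs) \<le> h + 2 * length Fs"
  by (induction Fs) (auto simp: le_Suc_eq, fastforce+)

text \<open>Sharing of gates is undone by unfolding the circuit into a tree; the formula may become
  large, but only its height matters. A gate costs at most 2b + 2 levels: 2b for a chain of at most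
  b arguments, and two negations in the case of a disjunction.\<close>

lemma gate_formula:
  assumes "is_circuit n C" "fan_in_at_most b C"
  shows "k < length (gates C) \<Longrightarrow> \<exists>F. formula_vars F \<subseteq> {..<n} \<and>
    height F \<le> (2 * b + 2) * gate_depths (gates C) ! k \<and>
    (\<forall>x. formula_eval F x = gate_values x (gates C) ! k)"
proof (induction k rule: less_induct)
  case (less k)
  define g where "g = gates C ! k"
  define ds where "ds = gate_depths (gates C)"
  have gmem: "g \<in> set (gates C)" using less.prems by (simp add: g_def)
  have args: "j < k" if "j \<in> set (gate_args g)" for j
    using assms(1) less.prems that by (auto simp: is_circuit_def g_def)
  have fan: "length (gate_args g) \<le> b"
    using assms(2) gmem by (simp add: fan_in_at_most_def)
  have depth: "ds ! k = gate_depth (take k ds) g"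
    unfolding ds_def g_def by (rule nth_gate_depths[OF less.prems])
  \<comment> \<open>All arguments precede k, so the prefix of values may be replaced by the whole
    list.\<close>
  have eval: "gate_values x (gates C) ! k = gate_value x (gate_values x (gates C)) g" for x
    unfolding nth_gate_values[OF less.prems] g_def[symmetric]
    by (rule gate_value_cong) (simp add: args)
  have "\<forall>j\<in>set (gate_args g). \<exists>F. formula_vars F \<subseteq> {..<n} \<and> height F \<le> (2 * b + 2) * ds ! j \<and>
      (\<forall>x. formula_eval F x = gate_values x (gates C) ! j)"
    using less.IH less.prems args unfolding ds_def by (meson less_trans)
  then obtain f where f: "\<And>j. j \<in> set (gate_args g) \<Longrightarrow> formula_vars (f j) \<subseteq> {..<n}"
      "\<And>j. j \<in> set (gate_args g) \<Longrightarrow> height (f j) \<le> (2 * b + 2) * ds ! j"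
      "\<And>j x. j \<in> set (gate_args g) \<Longrightarrow> formula_eval (f j) x = gate_values x (gates C) ! j"
    by metis
  have step: "(2 * b + 2) * ds ! j + (2 * b + 2) \<le> (2 * b + 2) * ds ! k"
    if "j \<in> set (gate_args g)" for j
  proof -
    have "Suc (ds ! j) \<le> ds ! k"
      using gate_depth_arg[OF that, of "take k ds"] args[OF that] by (simp add: depth)
    then have "(2 * b + 2) * Suc (ds ! j) \<le> (2 * b + 2) * ds ! k" by (rule mult_left_mono) simp
    then show ?thesis by simp
  qed
  have height: "height (f j) \<le> (2 * b + 2) * ds ! k - (2 * b + 2)" if "j \<in> set (gate_args g)" for j
    using f(2)[OF that] step[OF that] by linarith
  \<comment> \<open>This makes the truncated subtraction in \<open>height\<close> a genuine one. It
    also covers gates with an empty argument list, whose depth is 1.\<close>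
  have big: "2 * b + 2 \<le> (2 * b + 2) * ds ! k" if "gate_depth (take k ds) g \<noteq> 0"
    using mult_le_mono2[of 1 "ds ! k" "2 * b + 2"] that by (simp add: depth)
  have conj_height: "height (formula_conj Fs) \<le> h + 2 * b"
    if "length Fs = length (gate_args g)" "\<And>F. F \<in> set Fs \<Longrightarrow> height F \<le> h" for Fs h
    using height_formula_conj_le[OF that(2), of Fs] that(1) fan by linarith
  show ?case
  proof (cases g)
    case (GIn i)
    then have "i < n" using assms(1) gmem by (auto simp: is_circuit_def)
    then show ?thesis using GIn by (intro exI[of _ "Var i"]) (simp add: eval)
  next
    case (GNot j)
    then show ?thesis using f[of j] step[of j]
      by (intro exI[of _ "Nand (f j) Truth"]) (auto simp: eval ds_def)
  next
    case (GAnd ks)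
    have "height (formula_conj (map f ks)) \<le> (2 * b + 2) * ds ! k - (2 * b + 2) + 2 * b"
      by (rule conj_height) (use height GAnd in auto)
    also have "\<dots> \<le> (2 * b + 2) * ds ! k"
      using big GAnd by simp
    finally have "height (formula_conj (map f ks)) \<le> (2 * b + 2) * ds ! k" .
    then show ?thesis using f GAnd
      by (intro exI[of _ "formula_conj (map f ks)"]) (auto simp: eval ds_def)
  next
    case (GOr ks)
    \<comment> \<open>De Morgan: the arguments are negated, conjoined, and the result is negated
      once more.\<close>
    let ?F = "formula_conj (map (\<lambda>j. Nand (f j) Truth) ks)"
    have "height ?F \<le> Suc ((2 * b + 2) * ds ! k - (2 * b + 2)) + 2 * b"
      by (rule conj_height) (use height GOr in auto)
    then have "height (Nand ?F Truth) \<le> (2 * b + 2) * ds ! k"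
      using big GOr by simp
    then show ?thesis using f GOr
      by (intro exI[of _ "Nand ?F Truth"]) (auto simp: eval ds_def)
  qed
qed

lemma bigo_log_affine:
  fixes d :: "nat \<Rightarrow> nat"
  assumes "(\<lambda>n. real (d n)) \<in> O(\<lambda>n. log 2 (real n))"
  shows "(\<lambda>n. real (a * d n + b)) \<in> O(\<lambda>n. log 2 (real n))"
proof -
  have "(\<lambda>n::nat. real b) \<in> O(\<lambda>n. log 2 (real n))" by real_asymp
  moreover have "(\<lambda>n. real a * real (d n)) \<in> O(\<lambda>n. log 2 (real n))"
    using assms by simp
  ultimately show ?thesis by (simp add: sum_in_bigo)
qed

lemma NC1_formulas:
  assumes "L \<in> NC1"
  obtains F d where "(\<lambda>n. real (d n)) \<in> O(\<lambda>n. log 2 (real n))"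
    "\<And>n. formula_vars (F n) \<subseteq> {..<n}" "\<And>n. height (F n) \<le> d n"
    "\<And>x. formula_eval (F (length x)) x \<longleftrightarrow> x \<in> L"
proof -
  from assms obtain C b where C: "\<And>n. is_circuit n (C n)" "\<And>n. fan_in_at_most b (C n)"
      "(\<lambda>n. real (circuit_depth (C n))) \<in> O(\<lambda>n. log 2 (real n))"
      "\<And>x. circuit_eval (C (length x)) x = [x \<in> L]"
    by (auto simp: NC1_def)
  have "\<exists>F. formula_vars F \<subseteq> {..<n} \<and> height F \<le> (2 * b + 2) * circuit_depth (C n) \<and>
      (\<forall>x. length x = n \<longrightarrow> formula_eval F x = (x \<in> L))" for n
  proof -
    \<comment> \<open>The circuit returns a one-element list on every input of length n; an
      arbitrary such input shows that there is a single output gate.\<close>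
    have "length (outputs (C n)) = 1"
      using arg_cong[OF C(4)[of "replicate n True"], of length] by (simp add: circuit_eval_def)
    then obtain k where k: "outputs (C n) = [k]" by (auto simp: length_Suc_conv)
    then have len: "k < length (gates (C n))" using C(1)[of n] by (simp add: is_circuit_def)
    from gate_formula[OF C(1,2) len] obtain F where F: "formula_vars F \<subseteq> {..<n}"
      "height F \<le> (2 * b + 2) * gate_depths (gates (C n)) ! k"
      "\<And>x. formula_eval F x = gate_values x (gates (C n)) ! k" by blast
    have "gate_depths (gates (C n)) ! k \<le> circuit_depth (C n)"
      unfolding circuit_depth_def by (rule Max_ge) (use len in \<open>auto simp: length_gate_depths\<close>)
    then have "height F \<le> (2 * b + 2) * circuit_depth (C n)"
      using F(2) by (meson le_trans mult_le_mono2)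
    moreover have "formula_eval F x = (x \<in> L)" if "length x = n" for x
      using C(4)[of x] that k F(3) by (simp add: circuit_eval_def)
    ultimately show ?thesis using F(1) by blast
  qed
  then obtain F where F: "\<And>n. formula_vars (F n) \<subseteq> {..<n} \<and>
      height (F n) \<le> (2 * b + 2) * circuit_depth (C n) \<and>
      (\<forall>x. length x = n \<longrightarrow> formula_eval (F n) x = (x \<in> L))" by metis
  show ?thesis
    by (rule that[of "\<lambda>n. (2 * b + 2) * circuit_depth (C n)" F])
      (use F bigo_log_affine[OF C(3), of "2 * b + 2" 0] in auto)
qed

section \<open>Words witnessing efficient non-solvability\<close>

text \<open>Surjectivity gives each letter a word of equal value over the other alphabet;
  \<open>K\<close> is the longest of these finitely many words. Formal inverse letters are
  translated independently, so formal inversion is respected only up to value.\<close>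

lemma (in group) word_translation:
  assumes S: "standard_generating G S \<phi>" and T: "standard_generating G T \<psi>"
  obtains t K where "\<And>u. u \<in> lists (Sigma_of T) \<Longrightarrow> t u \<in> lists (Sigma_of S)"
    "\<And>u. u \<in> lists (Sigma_of T) \<Longrightarrow> word_eval G \<phi> (t u) = word_eval G \<psi> u"
    "\<And>u. u \<in> lists (Sigma_of T) \<Longrightarrow> length (t u) \<le> K * length u"
proof -
  have gens: "\<phi> ` S \<subseteq> carrier G" "\<psi> ` T \<subseteq> carrier G"
    using S T by (auto simp: standard_generating_def)
  have "\<forall>a\<in>Sigma_of T. \<exists>w. w \<in> lists (Sigma_of S) \<and> word_eval G \<phi> w = word_eval G \<psi> [a]"
  proof
    fix a assume "a \<in> Sigma_of T"
    then have "word_eval G \<psi> [a] \<in> carrier G" by (intro word_eval_closed[OF gens(2)]) auto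
    then have "word_eval G \<psi> [a] \<in> word_eval G \<phi> ` lists (Sigma_of S)"
      using S by (simp add: standard_generating_def)
    then show "\<exists>w. w \<in> lists (Sigma_of S) \<and> word_eval G \<phi> w = word_eval G \<psi> [a]" by force
  qed
  then obtain t where t: "\<And>a. a \<in> Sigma_of T \<Longrightarrow> t a \<in> lists (Sigma_of S)"
      "\<And>a. a \<in> Sigma_of T \<Longrightarrow> word_eval G \<phi> (t a) = word_eval G \<psi> [a]" by metis
  have fin: "finite (Sigma_of T)" using T by (simp add: standard_generating_def Sigma_of_def)
  define K where "K = Max ((length \<circ> t) ` Sigma_of T)"
  have K: "length (t a) \<le> K" if "a \<in> Sigma_of T" for a
    unfolding K_def using fin that by (auto intro!: Max_ge)
  show ?thesis
  proof (rule that[of "\<lambda>u. concat (map t u)" K])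
    fix u assume u: "u \<in> lists (Sigma_of T)"
    show "concat (map t u) \<in> lists (Sigma_of S)"
      using u t(1) by (fastforce simp: in_lists_conv_set)
    have "word_eval G \<phi> (concat (map t u)) = word_eval G \<psi> (concat (map (\<lambda>a. [a]) u))"
      by (rule word_eval_concat_cong[OF gens]) (use u t in auto)
    then show "word_eval G \<phi> (concat (map t u)) = word_eval G \<psi> u" by simp
    show "length (concat (map t u)) \<le> K * length u"
      using u by (induction u) (auto dest: K)
  qed
qed

text \<open>The Landau bound holds only from some threshold on. The maximum \<open>M\<close> absorbs
  the finitely many exceptions, and \<open>Suc d\<close> in place of d leaves room for them at d =
  0.\<close>

lemma powr_bigo_bound:
  fixes e :: "nat \<Rightarrow> real"
  assumes "e \<in> O(\<lambda>d. real d)"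
  obtains A :: nat where "\<And>d. 2 powr e d \<le> 2 ^ (A * Suc d)"
proof -
  from assms obtain c where "\<forall>\<^sub>F d in sequentially. norm (e d) \<le> c * norm (real d)"
    by (auto elim!: landau_o.bigE)
  then obtain N where N: "\<And>d. d \<ge> N \<Longrightarrow> \<bar>e d\<bar> \<le> c * real d"
    by (auto simp: eventually_sequentially)
  define M where "M = Max (insert 0 (e ` {..<N}))"
  have M: "e d \<le> M" if "d < N" for d unfolding M_def using that by (intro Max_ge) auto
  define A where "A = nat \<lceil>max c M\<rceil>"
  have A: "c \<le> real A" "M \<le> real A" unfolding A_def by linarith+
  have "e d \<le> real (A * Suc d)" for d
  proof (cases "d < N")
    case True
    have "e d \<le> real A * 1" using M[OF True] A by simp
    also have "\<dots> \<le> real A * real (Suc d)" by (intro mult_left_mono) auto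
    finally show ?thesis by (simp only: of_nat_mult)
  next
    case False
    have "e d \<le> c * real d" using N[of d] False by simp
    also have "\<dots> \<le> real A * real d" using A by (intro mult_right_mono) auto
    also have "\<dots> \<le> real A * real (Suc d)" by (intro mult_left_mono) auto
    finally show ?thesis by (simp only: of_nat_mult)
  qed
  then have "2 powr e d \<le> 2 powr real (A * Suc d)" for d by (intro powr_mono) auto
  then show ?thesis by (intro that[of A]) (simp only: powr_realpow[of 2] zero_less_numeral)
qed

text \<open>ENS bounds the words at the leaves only. Climbing k levels towards the root multiplies
  the bound by 2l each time.\<close>

lemma length_commutator_tree_le:
  fixes g :: "nat list \<Rightarrow> 's letter list"
  assumes leaf: "\<And>v. v \<in> lists {1..l} \<Longrightarrow> length v = d \<Longrightarrow> length (g v) \<le> M"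
    and node: "\<And>v. v \<in> lists {1..l} \<Longrightarrow> length v < d \<Longrightarrow>
        g v = comm_prod l (\<lambda>i. g (v @ [2 * i - 1])) (\<lambda>i. g (v @ [2 * i]))"
  shows "v \<in> lists {1..l} \<Longrightarrow> length v + k = d \<Longrightarrow> length (g v) \<le> (2 * l) ^ k * M"
proof (induction k arbitrary: v)
  case 0
  then show ?case using leaf by simp
next
  case (Suc k)
  have "length (g (v @ [2 * i - 1])) \<le> (2 * l) ^ k * M \<and> length (g (v @ [2 * i])) \<le> (2 * l) ^ k * M"
    if "i \<in> {1..l div 2}" for i
    using Suc.prems child_index[OF Suc.prems(1) that] by (intro conjI Suc.IH) auto
  moreover have "g v = comm_prod l (\<lambda>i. g (v @ [2 * i - 1])) (\<lambda>i. g (v @ [2 * i]))"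
    using Suc.prems by (intro node) auto
  ultimately have "length (g v) \<le> 2 * l * ((2 * l) ^ k * M)" by (simp only: length_comm_prod_le)
  then show ?case by (simp add: mult.assoc)
qed

text \<open>ENS is given by some generating set; this moves its words to the prescribed one. The
  price is that the recursion holds in value only, so the lengths of inner words are bounded before
  translating, while it still is an identity of words.\<close>

lemma (in group) ENS_words:
  assumes ENS: "efficiently_non_solvable G" and S: "standard_generating G S \<phi>"
  obtains l c w where
    "\<And>d v. v \<in> lists {1..l} \<Longrightarrow> length v \<le> d \<Longrightarrow> w d v \<in> lists (Sigma_of S)"
    "\<And>d v. v \<in> lists {1..l} \<Longrightarrow> length v \<le> d \<Longrightarrow> length (w d v) \<le> 2 ^ (c * Suc d)"
    "\<And>d v. v \<in> lists {1..l} \<Longrightarrow> length v < d \<Longrightarrow> word_eval G \<phi> (w d v) =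
       word_eval G \<phi> (comm_prod l (\<lambda>i. w d (v @ [2 * i - 1])) (\<lambda>i. w d (v @ [2 * i])))"
    "\<And>d. word_eval G \<phi> (w d []) \<noteq> \<one>"
proof -
  from ENS obtain T :: "nat set" and \<psi> where T: "standard_generating G T \<psi>" "ENS_wrt G T \<psi>"
    unfolding efficiently_non_solvable_def by blast
  from T(2) obtain l g e where e: "e \<in> O(\<lambda>d. real d)" and "\<forall>d.
      (\<forall>v\<in>lists {1..l}. length v \<le> d \<longrightarrow> g d v \<in> lists (Sigma_of T)) \<and>
      (\<forall>v\<in>lists {1..l}. length v = d \<longrightarrow> real (length (g d v)) \<le> 2 powr e d) \<and>
      (\<forall>v\<in>lists {1..l}. length v < d \<longrightarrow>
        g d v = comm_prod l (\<lambda>i. g d (v @ [2 * i - 1])) (\<lambda>i. g d (v @ [2 * i]))) \<and>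
      word_eval G \<psi> (g d []) \<noteq> \<one>"
    unfolding ENS_wrt_def comm_prod_def[symmetric] by (elim exE conjE) (rule that, assumption+)
  then have g:
    "\<And>d v. v \<in> lists {1..l} \<Longrightarrow> length v \<le> d \<Longrightarrow> g d v \<in> lists (Sigma_of T)"
    "\<And>d v. v \<in> lists {1..l} \<Longrightarrow> length v = d \<Longrightarrow> real (length (g d v)) \<le> 2 powr e d"
    "\<And>d v. v \<in> lists {1..l} \<Longrightarrow> length v < d \<Longrightarrow>
        g d v = comm_prod l (\<lambda>i. g d (v @ [2 * i - 1])) (\<lambda>i. g d (v @ [2 * i]))"
    "\<And>d. word_eval G \<psi> (g d []) \<noteq> \<one>"
    by (simp_all only: Ball_def simp_thms)
  have gens: "\<phi> ` S \<subseteq> carrier G" "\<psi> ` T \<subseteq> carrier G"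
    using S T by (auto simp: standard_generating_def)
  obtain t K where t: "\<And>u. u \<in> lists (Sigma_of T) \<Longrightarrow> t u \<in> lists (Sigma_of S)"
    "\<And>u. u \<in> lists (Sigma_of T) \<Longrightarrow> word_eval G \<phi> (t u) = word_eval G \<psi> u"
    "\<And>u. u \<in> lists (Sigma_of T) \<Longrightarrow> length (t u) \<le> K * length u"
    using word_translation[OF S T(1)] by metis
  obtain A where A: "\<And>d. 2 powr e d \<le> 2 ^ (A * Suc d)" using powr_bigo_bound[OF e] by blast
  show ?thesis
  \<comment> \<open>In the exponent, A comes from the leaves, 2l from replacing the factor 2l of
    each level by 2^(2l), and K from bounding the cost of translation by 2^K.\<close>
  proof (rule that[of l "\<lambda>d v. t (g d v)" "A + 2 * l + K"])
    fix d v assume v: "v \<in> lists {1..l}" "length v \<le> d"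
    show "t (g d v) \<in> lists (Sigma_of S)" using v by (intro t g)
    have leaf: "length (g d v') \<le> 2 ^ (A * Suc d)" if "v' \<in> lists {1..l}" "length v' = d" for v'
    proof -
      have "real (length (g d v')) \<le> 2 ^ (A * Suc d)" using g(2)[OF that] A[of d] by linarith
      then show ?thesis by (metis of_nat_le_iff of_nat_numeral of_nat_power)
    qed
    have K: "K \<le> 2 ^ K" using less_exp[of K] by simp
    have l: "2 * l \<le> 2 ^ (2 * l)" using less_exp[of "2 * l"] by simp
    have "length (t (g d v)) \<le> K * length (g d v)" using v by (intro t g)
    also have "\<dots> \<le> K * ((2 * l) ^ (d - length v) * 2 ^ (A * Suc d))"
      by (intro mult_left_mono length_commutator_tree_le[where d = d and l = l])
        (use v leaf g(3) in auto)
    also have "\<dots> \<le> 2 ^ K * ((2 ^ (2 * l)) ^ (d - length v) * 2 ^ (A * Suc d))"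
      using K l by (intro mult_mono power_mono) auto
    also have "\<dots> = 2 ^ (K + 2 * l * (d - length v) + A * Suc d)"
      by (simp add: power_add power_mult)
    also have "\<dots> \<le> 2 ^ ((A + 2 * l + K) * Suc d)"
    proof (rule power_increasing)
      have "2 * l * (d - length v) \<le> 2 * l * Suc d" "K * 1 \<le> K * Suc d"
        by (rule mult_le_mono2; simp)+
      then show "K + 2 * l * (d - length v) + A * Suc d \<le> (A + 2 * l + K) * Suc d"
        by (simp add: add_mult_distrib)
    qed simp
    finally show "length (t (g d v)) \<le> 2 ^ ((A + 2 * l + K) * Suc d)" .
  next
    fix d v assume v: "v \<in> lists {1..l}" "length v < d"
    have children: "g d (v @ [2 * i - 1]) \<in> lists (Sigma_of T)" "g d (v @ [2 * i]) \<in> lists (Sigma_of T)"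
      if "i \<in> {1..l div 2}" for i
      using v child_index[OF v(1) that] by (intro g; simp)+
    have "word_eval G \<phi> (t (g d v)) = word_eval G \<psi> (g d v)" using v by (intro t g) auto
    also have "\<dots> = word_eval G \<psi> (comm_prod l (\<lambda>i. g d (v @ [2 * i - 1])) (\<lambda>i. g d (v @ [2 * i])))"
      using g(3)[OF v] by simp
    also have "\<dots> = word_eval G \<phi> (comm_prod l (\<lambda>i. t (g d (v @ [2 * i - 1]))) (\<lambda>i. t (g d (v @ [2 * i]))))"
      by (rule comm_prod_cong[OF gens(2,1)]) (simp_all only: t children simp_thms)
    finally show "word_eval G \<phi> (t (g d v)) =
      word_eval G \<phi> (comm_prod l (\<lambda>i. t (g d (v @ [2 * i - 1]))) (\<lambda>i. t (g d (v @ [2 * i]))))" .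
  next
    show "word_eval G \<phi> (t (g d [])) \<noteq> \<one>" for d
      using g(4)[of d] t(2)[of "g d []"] g(1)[of "[]" d] by simp
  qed
qed

section \<open>Programs of polynomial length\<close>

lemma word_eval_append_Ones:
  assumes "group G"
  shows "word_eval G \<phi> (w @ replicate k One) = word_eval G \<phi> w"
proof -
  interpret group G by fact
  have "word_eval G \<phi> (replicate k One) = \<one>\<^bsub>G\<^esub>" by (induction k) (simp_all add: word_eval_def)
  then show ?thesis by (simp add: word_eval_def)
qed

text \<open>The length is padded to an exact power of two because a projection must have output
  lengths of this form.\<close>

lemma NC1_programs:
  fixes S :: "'s set"
  assumes "group G" "efficiently_non_solvable G" "standard_generating G S \<phi>" "L \<in> NC1"
  obtains P q where "(\<lambda>n. real (q n)) \<in> O(\<lambda>n. log 2 (real n))"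
    "\<And>n. n \<ge> 1 \<Longrightarrow> is_program S n (P n)" "\<And>n. length (P n) = 2 ^ q n" "recognizes G \<phi> P L"
proof -
  interpret group G by fact
  have gens: "\<phi> ` S \<subseteq> carrier G" using assms(3) by (simp add: standard_generating_def)
  obtain l c w where w:
    "\<And>d v. v \<in> lists {1..l} \<Longrightarrow> length v \<le> d \<Longrightarrow> w d v \<in> lists (Sigma_of S)"
    "\<And>d v. v \<in> lists {1..l} \<Longrightarrow> length v \<le> d \<Longrightarrow> length (w d v) \<le> 2 ^ (c * Suc d)"
    "\<And>d v. v \<in> lists {1..l} \<Longrightarrow> length v < d \<Longrightarrow> word_eval G \<phi> (w d v) =
       word_eval G \<phi> (comm_prod l (\<lambda>i. w d (v @ [2 * i - 1])) (\<lambda>i. w d (v @ [2 * i])))"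
    "\<And>d. word_eval G \<phi> (w d []) \<noteq> \<one>\<^bsub>G\<^esub>"
    using ENS_words[OF assms(2,3)] by metis
  obtain F d where d: "(\<lambda>n. real (d n)) \<in> O(\<lambda>n. log 2 (real n))"
    and F: "\<And>n. formula_vars (F n) \<subseteq> {..<n}" "\<And>n. height (F n) \<le> d n"
      "\<And>x. formula_eval (F (length x)) x \<longleftrightarrow> x \<in> L"
    using NC1_formulas[OF assms(4)] by metis
  \<comment> \<open>A program evaluates to \<open>\<one>\<close> iff its formula is false, so the complement of \<open>L\<close> is simulated.\<close>
  define E where "E n = Nand (F n) Truth" for n
  have E: "formula_vars (E n) \<subseteq> {..<n}" "height (E n) \<le> Suc (d n)" for n
    using F by (auto simp: E_def)
  define Q where "Q n = nand_program l (w (Suc (d n))) (E n) []" for n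
  \<comment> \<open>This is c(d + 2) + 2l(d + 1): the first summand bounds the words for trees of
    depth d + 1, the second the growth over at most d + 1 NAND levels, as 2l + 1 is at most
    2^(2l).\<close>
  define q where "q n = (c + 2 * l) * d n + (2 * c + 2 * l)" for n
  define P where "P n = Q n @ replicate (2 ^ q n - length (Q n)) (1, One, One)" for n
  have len: "length (Q n) \<le> 2 ^ q n" for n
  proof -
    have "length (Q n) \<le> 2 ^ (c * Suc (Suc (d n))) * Suc (2 * l) ^ height (E n)"
      unfolding Q_def by (rule length_nand_program_le[where d = "Suc (d n)", OF w(2)]) (use E in auto)
    also have "\<dots> \<le> 2 ^ (c * Suc (Suc (d n))) * (2 ^ (2 * l)) ^ height (E n)"
      using less_exp[of "2 * l"] by (intro mult_left_mono power_mono Suc_leI) auto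
    also have "\<dots> \<le> 2 ^ (c * Suc (Suc (d n))) * (2 ^ (2 * l)) ^ Suc (d n)"
      using E by (intro mult_left_mono power_increasing) auto
    also have "\<dots> = 2 ^ (c * Suc (Suc (d n)) + 2 * l * Suc (d n))"
      by (simp only: power_add power_mult)
    also have "c * Suc (Suc (d n)) + 2 * l * Suc (d n) = q n"
      by (simp add: q_def algebra_simps)
    finally show ?thesis .
  qed
  show ?thesis
  proof (rule that[of q P])
    show "(\<lambda>n. real (q n)) \<in> O(\<lambda>n. log 2 (real n))"
      unfolding q_def by (rule bigo_log_affine[OF d])
    show "is_program S n (P n)" if "n \<ge> 1" for n
    proof -
      have "is_program S n (Q n)"
        unfolding Q_def by (rule is_program_nand_program[where d = "Suc (d n)", OF that w(1)]) (use E in auto)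
      then show ?thesis using that by (auto simp: P_def is_program_def Sigma_of_def)
    qed
    show "length (P n) = 2 ^ q n" for n using len[of n] by (simp add: P_def)
    show "recognizes G \<phi> P L"
      unfolding recognizes_def
    proof (intro allI impI)
      fix x :: "bool list" assume "x \<noteq> []"
      define n where "n = length x"
      have n: "n \<ge> 1" using \<open>x \<noteq> []\<close> by (cases x) (auto simp: n_def)
      have "program_output (P n) x = program_output (Q n) x @ replicate (2 ^ q n - length (Q n)) One"
        by (simp add: P_def program_output_def)
      then have "word_eval G \<phi> (program_output (P n) x) = word_eval G \<phi> (program_output (Q n) x)"
        by (simp add: word_eval_append_Ones[OF assms(1)])
      also have "\<dots> = (if formula_eval (E n) x then word_eval G \<phi> (w (Suc (d n)) []) else \<one>\<^bsub>G\<^esub>)"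
        unfolding Q_def
        by (rule word_eval_nand_program[OF gens n w(1,3), where d = "Suc (d n)"]) (use E in auto)
      finally show "x \<in> L \<longleftrightarrow> word_eval G \<phi> (program_output (P (length x)) x) = \<one>\<^bsub>G\<^esub>"
        using w(4) F(3)[of x] by (simp add: E_def n_def)
    qed
  qed
qed

lemma polynomially_bounded_power2:
  assumes "(\<lambda>n. real (q n)) \<in> O(\<lambda>n. log 2 (real n))"
  shows "polynomially_bounded (\<lambda>n. 2 ^ q n)"
proof -
  from assms obtain c where c: "\<forall>\<^sub>F n in sequentially. norm (real (q n)) \<le> c * norm (log 2 (real n))"
    by (auto elim!: landau_o.bigE)
  define k where "k = nat \<lceil>c\<rceil>"
  have k: "c \<le> real k" unfolding k_def by linarith
  have "\<forall>\<^sub>F n in sequentially. norm (real (2 ^ q n)) \<le> 1 * norm (real n ^ k)"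
    using c eventually_ge_at_top[of 1]
  proof eventually_elim
    case (elim n)
    then have log: "log 2 (real n) \<ge> 0" by simp
    have "real (q n) \<le> c * log 2 (real n)" using elim log by simp
    also have "\<dots> \<le> real k * log 2 (real n)" using k log by (intro mult_right_mono)
    finally have "2 powr real (q n) \<le> 2 powr (log 2 (real n) * real k)"
      by (intro powr_mono) (simp_all add: mult.commute)
    also have "\<dots> = real n ^ k"
      using elim by (simp add: powr_powr[symmetric] powr_realpow)
    finally show ?case by (simp add: powr_realpow)
  qed
  then have "(\<lambda>n. real (2 ^ q n)) \<in> O(\<lambda>n. real n ^ k)" by (rule bigoI)
  then show ?thesis unfolding polynomially_bounded_def by blast
qed

section \<open>Reductions\<close>

text \<open>Blocks of one positive length can be cut off and decoded one by one. Hence an encoded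
  word lies in the binary word problem exactly if the word itself lies in the word problem.\<close>

lemma inj_on_concat_map:
  assumes enc: "inj_on enc A" "\<And>a. a \<in> A \<Longrightarrow> length (enc a) = m" and "m > 0"
  shows "inj_on (\<lambda>w. concat (map enc w)) (lists A)"
proof (rule inj_onI)
  fix u w assume "u \<in> lists A" "w \<in> lists A" "concat (map enc u) = concat (map enc w)"
  then show "u = w"
  proof (induction u arbitrary: w rule: list.induct)
    case Nil
    then show ?case using enc(2) \<open>m > 0\<close> by (cases w) auto
  next
    case (Cons a u)
    then obtain b w' where w: "w = b # w'" using enc(2)[of a] \<open>m > 0\<close> by (cases w) auto
    have "a \<in> A" "b \<in> A" using Cons.prems w by auto
    then have "enc a = enc b \<and> concat (map enc u) = concat (map enc w')"
      using Cons.prems enc(2)[of a] enc(2)[of b] by (simp add: w)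
    moreover have "u = w'"
      by (rule Cons.IH) (use Cons.prems calculation in \<open>simp_all add: w\<close>)
    ultimately show ?case using inj_onD[OF enc(1), of a b] \<open>a \<in> A\<close> \<open>b \<in> A\<close> by (simp add: w)
  qed
qed

lemma length_concat_uniform:
  "(\<And>xs. xs \<in> set xss \<Longrightarrow> length xs = m) \<Longrightarrow> length (concat xss) = length xss * m"
  by (induction xss) simp_all

lemma nth_concat_uniform:
  "(\<And>xs. xs \<in> set xss \<Longrightarrow> length xs = m) \<Longrightarrow> i < length xss * m \<Longrightarrow>
    concat xss ! i = xss ! (i div m) ! (i mod m)"
proof (induction xss arbitrary: i)
  case (Cons xs xss)
  show ?case
  proof (cases "i < m")
    case True
    then show ?thesis using Cons.prems by (simp add: nth_append)
  next
    case False
    moreover have "m > 0" using Cons.prems by (cases m) auto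
    ultimately show ?thesis
      using Cons.IH[of "i - m"] Cons.prems by (simp add: nth_append le_div_geq le_mod_geq)
  qed
qed simp

text \<open>A function of one bit is the bit, its negation or a constant. One list of 2n + 2 gates
  provides all of these, and the output list only selects among them.\<close>

lemma projection_imp_AC0:
  assumes "projection f"
  shows "AC0_function f"
proof -
  from assms obtain d where d: "(\<lambda>n. real (d n)) \<in> O(\<lambda>n. log 2 (real n))"
      and len: "\<forall>x. length (f x) = 2 ^ d (length x)"
      and bits: "\<forall>n\<ge>1. \<forall>i\<in>{1..2 ^ d n}. \<exists>j\<in>{1..n}. \<exists>a b.
         \<forall>x. length x = n \<longrightarrow> f x ! (i - 1) = (if x ! (j - 1) then a else b)"
    unfolding projection_def by (elim exE conjE) (rule that, assumption+)
  define gs where "gs n = map GIn [0..<n] @ map GNot [0..<n] @ [GAnd [], GOr []]" for n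
  have lgs: "length (gs n) = 2 * n + 2" for n by (simp add: gs_def)
  have gin: "gs n ! k = GIn k" if "k < n" for n k using that by (simp add: gs_def nth_append)
  have gnot: "gs n ! (n + k) = GNot k" if "k < n" for n k using that by (simp add: gs_def nth_append)
  have gtrue: "gs n ! (2 * n) = GAnd []" for n by (simp add: gs_def nth_append)
  have gfalse: "gs n ! Suc (2 * n) = GOr []" for n by (simp add: gs_def nth_append)
  have index: "k < n \<or> (\<exists>j<n. k = n + j) \<or> k = 2 * n \<or> k = Suc (2 * n)" if "k < 2 * n + 2" for n k :: nat
  proof -
    have "k < n \<or> (k - n < n \<and> k = n + (k - n)) \<or> k = 2 * n \<or> k = Suc (2 * n)"
      using that by linarith
    then show ?thesis by blast
  qed
  have vin: "gate_values x (gs n) ! k = x ! k" if "k < n" for n k x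
    using that by (simp add: nth_gate_values lgs gin)
  have vnot: "gate_values x (gs n) ! (n + k) = (\<not> x ! k)" if "k < n" for n k x
    using that by (simp add: nth_gate_values[of "n + k"] lgs gnot vin)
  have vconst: "gate_values x (gs n) ! (2 * n)" "\<not> gate_values x (gs n) ! Suc (2 * n)" for n x
    by (simp_all add: nth_gate_values lgs gtrue gfalse)
  have din: "gate_depths (gs n) ! k = 0" if "k < n" for n k
    using that by (simp add: nth_gate_depths lgs gin)
  have depth: "gate_depths (gs n) ! k \<le> 1" if "k < 2 * n + 2" for n k
    using index[OF that]
    by (auto simp: din nth_gate_depths[of "n + _"] nth_gate_depths[of "2 * n"]
        nth_gate_depths[of "Suc (2 * n)"] lgs gnot gtrue gfalse)
  have "\<exists>k<2 * n + 2. \<forall>x. length x = n \<longrightarrow> f x ! i = gate_values x (gs n) ! k" if "i < 2 ^ d n" for n i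
  proof (cases "n = 0")
    case True
    \<comment> \<open>The empty input is the only one of length 0, so each output bit is constant;
      gates 0 and 1 are then the constants true and false.\<close>
    then show ?thesis using vconst[of _ 0]
      by (intro exI[of _ "if f [] ! i then 0 else Suc 0"]) auto
  next
    case False
    then have n: "n \<ge> 1" and i: "Suc i \<in> {1..2 ^ d n}" using that by auto
    obtain j a b where j: "j \<in> {1..n}"
        and "\<forall>x. length x = n \<longrightarrow> f x ! (Suc i - 1) = (if x ! (j - 1) then a else b)"
      using bits[THEN spec, THEN mp, THEN bspec, OF n i] by (elim bexE exE) (rule that)
    then have f: "\<And>x. length x = n \<Longrightarrow> f x ! i = (if x ! (j - 1) then a else b)" by simp
    let ?k = "if a then (if b then 2 * n else j - 1) else (if b then n + (j - 1) else Suc (2 * n))"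
    have "j - 1 < n" using j by auto
    then show ?thesis
      using vin[of "j - 1" n] vnot[of "j - 1" n] vconst[of _ n] f by (intro exI[of _ ?k]) auto
  qed
  then have "\<forall>n i. \<exists>k. i < 2 ^ d n \<longrightarrow> k < 2 * n + 2 \<and>
      (\<forall>x. length x = n \<longrightarrow> f x ! i = gate_values x (gs n) ! k)" by blast
  then obtain out where "\<forall>n i. i < 2 ^ d n \<longrightarrow> out n i < 2 * n + 2 \<and>
      (\<forall>x. length x = n \<longrightarrow> f x ! i = gate_values x (gs n) ! out n i)"
    unfolding choice_iff by (elim exE) (rule that)
  then have out: "\<And>n i. i < 2 ^ d n \<Longrightarrow> out n i < 2 * n + 2"
      "\<And>n i x. i < 2 ^ d n \<Longrightarrow> length x = n \<Longrightarrow> f x ! i = gate_values x (gs n) ! out n i"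
    by blast+
  define C where "C n = Circuit (gs n) (map (out n) [0..<2 ^ d n])" for n
  have "is_circuit n (C n)" for n
  proof -
    have "j < k" if "k < 2 * n + 2" "j \<in> set (gate_args (gs n ! k))" for k j
      using index[OF that(1)] that(2) by (auto simp: gin gnot gtrue gfalse)
    moreover have "i < n" if "GIn i \<in> set (gs n)" for i using that by (auto simp: gs_def)
    ultimately show ?thesis using out(1)[of _ n] by (auto simp: is_circuit_def C_def lgs)
  qed
  moreover have "circuit_depth (C n) \<le> 1" for n
    using depth[of _ n] by (auto simp: circuit_depth_def C_def in_set_conv_nth length_gate_depths lgs)
  moreover have "polynomially_bounded (\<lambda>n. circuit_size (C n))"
  proof -
    from polynomially_bounded_power2[OF d] obtain k
      where k: "(\<lambda>n. real (2 ^ d n)) \<in> O(\<lambda>n. real n ^ k)"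
      unfolding polynomially_bounded_def by blast
    \<comment> \<open>The exponent is raised by one so that it also dominates the linear number of
      gates when k = 0.\<close>
    have "(\<lambda>n. real n ^ k) \<in> O(\<lambda>n. real n ^ Suc k)"
    proof (rule bigoI[of _ 1])
      show "\<forall>\<^sub>F n in sequentially. norm (real n ^ k) \<le> 1 * norm (real n ^ Suc k)"
        using eventually_ge_at_top[of 1] by eventually_elim (simp add: mult_le_cancel_right1)
    qed
    with k have "(\<lambda>n. real (2 ^ d n)) \<in> O(\<lambda>n. real n ^ Suc k)" by (rule landau_o.big_trans)
    moreover have "(\<lambda>n. 2 * real n + 2) \<in> O(\<lambda>n. real n ^ Suc k)"
    proof (rule bigoI[of _ 4])
      show "\<forall>\<^sub>F n in sequentially. norm (2 * real n + 2) \<le> 4 * norm (real n ^ Suc k)"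
        using eventually_ge_at_top[of 1]
      proof eventually_elim
        case (elim n)
        then have "real n * 1 \<le> real n * real n ^ k" by (intro mult_left_mono) auto
        then have "2 * real n + 2 \<le> 4 * real n ^ Suc k" using elim unfolding power_Suc by linarith
        then show ?case by simp
      qed
    qed
    ultimately have "(\<lambda>n. real (2 ^ d n) + (2 * real n + 2)) \<in> O(\<lambda>n. real n ^ Suc k)"
      by (rule sum_in_bigo(1))
    then have "(\<lambda>n. real (circuit_size (C n))) \<in> O(\<lambda>n. real n ^ Suc k)"
      by (simp add: circuit_size_def C_def lgs ac_simps)
    then show ?thesis unfolding polynomially_bounded_def by blast
  qed
  moreover have "f x = circuit_eval (C (length x)) x" for x
    by (rule nth_equalityI) (simp_all add: circuit_eval_def C_def len out(2))
  ultimately show ?thesis unfolding AC0_function_def by blast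
qed

text \<open>The reduction writes down the encoded output of a program for L. Each block of it comes
  from one instruction and so depends on one input bit.\<close>

lemma hard_under_projection:
  fixes S :: "'s set"
  assumes "group G" "efficiently_non_solvable G" "standard_generating G S \<phi>" "binary_encoding S enc"
  shows "hard_under projection NC1 (binary_word_problem G S \<phi> enc)"
  unfolding hard_under_def
proof
  fix L assume L: "L \<in> NC1"
  interpret group G by fact
  have gens: "\<phi> ` S \<subseteq> carrier G" using assms(3) by (simp add: standard_generating_def)
  obtain P q where q: "(\<lambda>n. real (q n)) \<in> O(\<lambda>n. log 2 (real n))"
    and P: "\<And>n. n \<ge> 1 \<Longrightarrow> is_program S n (P n)" "\<And>n. length (P n) = 2 ^ q n" "recognizes G \<phi> P L"
    using NC1_programs[OF assms(1-3) L] by metis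
  obtain k where enc: "inj_on enc (Sigma_of S)" "\<And>a. a \<in> Sigma_of S \<Longrightarrow> length (enc a) = 2 ^ k"
    using assms(4) by (auto simp: binary_encoding_def)
  have encode: "concat (map enc u) \<in> binary_word_problem G S \<phi> enc \<longleftrightarrow> word_eval G \<phi> u = \<one>\<^bsub>G\<^esub>"
    if u: "u \<in> lists (Sigma_of S)" for u
  proof -
    have "inj_on (\<lambda>w. concat (map enc w)) (lists (Sigma_of S))"
      by (rule inj_on_concat_map[OF enc]) auto
    then have "concat (map enc u) \<in> binary_word_problem G S \<phi> enc \<longleftrightarrow> u \<in> word_problem G S \<phi>"
      unfolding binary_word_problem_def using u
      by (intro inj_on_image_mem_iff) (auto simp: word_problem_def)
    then show ?thesis using u by (simp add: word_problem_def)
  qed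
  \<comment> \<open>An ENS group is nontrivial. A nontrivial letter supplies a no-instance for the
    empty input, which programs do not handle.\<close>
  have "\<exists>a\<in>Sigma_of S. letter_eval G \<phi> a \<noteq> \<one>\<^bsub>G\<^esub>"
  proof (rule ccontr)
    assume "\<not> ?thesis"
    then have trivial: "letter_eval G \<phi> a = \<one>\<^bsub>G\<^esub>" if "a \<in> Sigma_of S" for a using that by blast
    have "word_eval G \<phi> u = \<one>\<^bsub>G\<^esub>" if "u \<in> lists (Sigma_of S)" for u
      using that by (induction u) (auto simp: word_eval_def trivial)
    moreover obtain u where "u \<in> lists (Sigma_of S)" "word_eval G \<phi> u \<noteq> \<one>\<^bsub>G\<^esub>"
      using ENS_words[OF assms(2,3)] by (metis le0 list.size(3) lists.Nil)
    ultimately show False by blast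
  qed
  then obtain a where a: "a \<in> Sigma_of S" "letter_eval G \<phi> a \<noteq> \<one>\<^bsub>G\<^esub>" by blast
  define f where "f x = (if x = [] then enc (if [] \<in> L then One else a)
      else concat (map enc (program_output (P (length x)) x)))" for x
  define d where "d n = (if n = 0 then k else q n + k)" for n
  have out: "program_output (P (length x)) x \<in> lists (Sigma_of S)" if "x \<noteq> []" for x
    by (rule program_output_in_lists[OF P(1)]) (use that in \<open>cases x; simp\<close>)
  have lens: "length xs = 2 ^ k" if "x \<noteq> []" "xs \<in> set (map enc (program_output (P (length x)) x))" for x xs
    using that out[OF that(1)] enc(2) by auto
  have "many_one_reduction f L (binary_word_problem G S \<phi> enc)"
    unfolding many_one_reduction_def
  proof
    fix x
    show "x \<in> L \<longleftrightarrow> f x \<in> binary_word_problem G S \<phi> enc"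
    proof (cases "x = []")
      case True
      have "enc b \<in> binary_word_problem G S \<phi> enc \<longleftrightarrow> letter_eval G \<phi> b = \<one>\<^bsub>G\<^esub>"
        if "b \<in> Sigma_of S" for b
        using encode[of "[b]"] that letter_eval_closed[OF gens that] by (simp add: word_eval_def)
      from this[OF a(1)] this[of One] a(2) True show ?thesis by (auto simp: f_def Sigma_of_def)
    next
      case False
      then show ?thesis using encode[OF out[OF False]] P(3) by (auto simp: f_def recognizes_def)
    qed
  qed
  moreover have "projection f"
    unfolding projection_def
  proof (intro exI[of _ d] conjI allI impI ballI)
    have "(\<lambda>n. real (1 * q n + k)) \<in> O(\<lambda>n. log 2 (real n))" by (rule bigo_log_affine[OF q])
    moreover have "\<forall>\<^sub>F n in sequentially. real (d n) = real (1 * q n + k)"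
      using eventually_ge_at_top[of 1] by eventually_elim (simp add: d_def)
    ultimately show "(\<lambda>n. real (d n)) \<in> O(\<lambda>n. log 2 (real n))"
      by (simp add: landau_o.big.in_cong)
    show "length (f x) = 2 ^ d (length x)" for x
    proof (cases "x = []")
      case True
      then show ?thesis using enc(2) a(1) by (auto simp: f_def d_def Sigma_of_def)
    next
      case False
      then show ?thesis using length_concat_uniform[OF lens[OF False], of "map enc (program_output (P (length x)) x)"]
        by (simp add: f_def d_def P(2) power_add)
    qed
  next
    fix n i :: nat assume n: "1 \<le> n" and i: "i \<in> {1..2 ^ d n}"
    \<comment> \<open>Output position i - 1, counted from 0, is offset \<open>r\<close> in the block
      of instruction \<open>p\<close>, blocks having length 2^k.\<close>
    define p where "p = (i - 1) div 2 ^ k"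
    define r where "r = (i - 1) mod 2 ^ k"
    have i': "i - 1 < 2 ^ q n * 2 ^ k" using n i by (auto simp: d_def power_add)
    then have p: "p < length (P n)" by (simp add: p_def P(2) less_mult_imp_div_less)
    obtain j b c where Pp: "P n ! p = (j, b, c)" by (metis prod_cases3)
    then have "(j, b, c) \<in> set (P n)" using p by (metis nth_mem)
    then have "j \<in> {1..n}" using P(1)[OF n] by (auto simp: is_program_def)
    moreover have "f x ! (i - 1) = (if x ! (j - 1) then enc b ! r else enc c ! r)" if "length x = n" for x
    proof -
      have x: "x \<noteq> []" using that n by auto
      have "f x ! (i - 1) = map enc (program_output (P n) x) ! p ! r"
        using x i' nth_concat_uniform[OF lens[OF x], of "map enc (program_output (P (length x)) x)" "i - 1"]
        unfolding p_def r_def by (simp add: f_def that P(2))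
      also have "\<dots> = enc (program_output (P n) x ! p) ! r" using p by simp
      also have "program_output (P n) x ! p = (if x ! (j - 1) then b else c)"
        using p Pp by (simp add: program_output_def)
      finally show ?thesis by simp
    qed
    ultimately show "\<exists>j\<in>{1..n}. \<exists>a b. \<forall>x. length x = n \<longrightarrow> f x ! (i - 1) = (if x ! (j - 1) then a else b)"
      by blast
  qed
  ultimately show "\<exists>f. projection f \<and> many_one_reduction f L (binary_word_problem G S \<phi> enc)" by blast
qed

theorem theorem33:
  fixes G :: "('g, 'm) monoid_scheme" and S :: "'s set" and \<phi> :: "'s \<Rightarrow> 'g"
  assumes "group G"
    and "efficiently_non_solvable G"
    and "standard_generating G S \<phi>"
  shows "(\<forall>L\<in>NC1. \<exists>P. program_family S P \<and>
             polynomially_bounded (\<lambda>n. length (P n)) \<and> recognizes G \<phi> P L) \<and>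
         (\<forall>enc. binary_encoding S enc \<longrightarrow>
             hard_under projection NC1 (binary_word_problem G S \<phi> enc) \<and>
             hard_under AC0_function NC1 (binary_word_problem G S \<phi> enc))"
proof (intro conjI ballI allI impI)
  fix L assume "L \<in> NC1"
  then obtain P q where q: "(\<lambda>n. real (q n)) \<in> O(\<lambda>n. log 2 (real n))"
    and P: "\<And>n. n \<ge> 1 \<Longrightarrow> is_program S n (P n)" "\<And>n. length (P n) = 2 ^ q n" "recognizes G \<phi> P L"
    using NC1_programs[OF assms] by metis
  have "polynomially_bounded (\<lambda>n. length (P n))"
    unfolding P(2) by (rule polynomially_bounded_power2[OF q])
  then show "\<exists>P. program_family S P \<and> polynomially_bounded (\<lambda>n. length (P n)) \<and> recognizes G \<phi> P L"
    using P(1,3) unfolding program_family_def by blast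
next
  fix enc assume "binary_encoding S enc"
  then show projection: "hard_under projection NC1 (binary_word_problem G S \<phi> enc)"
    by (rule hard_under_projection[OF assms])
  then show "hard_under AC0_function NC1 (binary_word_problem G S \<phi> enc)"
    using projection_imp_AC0 unfolding hard_under_def by blast
qed

end
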